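(* Let $(V,c,b)$ be a braided Lie algebra over a field $K$. Then for each $n\in\mathbb N$, $$U^{[n+1]}=\frac{U^{[n]}}{\big(\mathrm{Ker}(b^{[n]})\big)},$$ where $(\mathrm{Ker}(b^{[n]}))$ is the two-sided ideal of $U^{[n]}$ generated by $\mathrm{Ker}(b^{[n]})\subseteq P^{[n]}$.
   Context: Fix a field $K$; all vector spaces, tensor products and maps are over $K$ ($K$-linear). An object also denotes its identity map. Braided vector space $(V,c)$: $c:V\otimes V\to V\otimes V$ linear with $(c\otimes V)(V\otimes c)(c\otimes V)=(V\otimes c)(c\otimes V)(V\otimes c)$; a morphism $f:(V,c_V)\to(W,c_W)$ is linear with $c_W(f\otimes f)=(f\otimes f)c_V$. Braided algebra $(A,m,u,c)$: an associative unital algebra and braided vector space with $c(m\otimes A)=(A\otimes m)(c\otimes A)(A\otimes c)$, $c(A\otimes m)=(m\otimes A)(A\otimes c)(c\otimes A)$, $c(u\otimes A)=A\otimes u$, $c(A\otimes u)=u\otimes A$. Braided coalgebra $(C,\Delta,\varepsilon,c)$: a coassociative counital coalgebra and braided vector space with $(\Delta\otimes C)c=(C\otimes c)(c\otimes C)(C\otimes\Delta)$, $(C\otimes\Delta)c=(c\otimes C)(C\otimes c)(\Delta\otimes C)$, $(\varepsilon\otimes C)c=C\otimes\varepsilon$, $(C\otimes\varepsilon)c=\varepsilon\otimes C$. Braided bialgebra $(B,m,u,\Delta,\varepsilon,c)$: a braided algebra and braided coalgebra with $\Delta m=(m\otimes m)(B\otimes c\otimes B)(\Delta\otimes\Delta)$,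 $\Delta(1)=1\otimes 1$, and $\varepsilon$ an algebra map. Morphisms of braided (bi)algebras are (bi)algebra maps that are morphisms of braided vector spaces. $P(B)=\{x\in B\mid \Delta(x)=x\otimes1+1\otimes x\}$. The braiding $c$ of $B$ satisfies $c(P(B)\otimes B)\subseteq B\otimes P(B)$ and $c(B\otimes P(B))\subseteq P(B)\otimes B$. A braided bialgebra map $f:B\to B'$ induces $P(f):P(B)\to P(B')$. Braided tensor algebra $T(V,c)$: the tensor algebra $T(V)$ with the unique braiding $c_T$ extending $c$ and making it a braided algebra, and with $\Delta_T$, $\varepsilon_T$ the algebra maps $\Delta_T:T(V)\to T(V)\otimes_c T(V)$, $\varepsilon_T:T(V)\to K$ such that $\Delta_T(v)=v\otimes1+1\otimes v$, $\varepsilon_T(v)=0$ for $v\in V$, where $T\otimes_cT$ has multiplication $(m_T\otimes m_T)(T\otimes c_T\otimes T)$. A bracket on a braided vector space $(V,c)$ is a family $b=(b^{[n]})_{n\in\mathbb N}$ of linear maps defined together with braided bialgebras $U^{[n]}$ and braided vector space morphisms $i^{[n]}:V\to P^{[n]}:=P(U^{[n]})$ as follows. $U^{[0]}=T(V,c)$ and $i^{[0]}$ is the inclusion. For each $n$, $b^{[n]}:P^{[n]}\to V$ is linear and, with $V^{[n]}:=i^{[n]}(V)$ and $c$ the braiding of $U^{[n]}$, one has on $P^{[n]}\otimes V^{[n]}$ and $V^{[n]}\otimes P^{[n]}$ respectively $c(i^{[n]}b^{[n]}\otimes V^{[n]})=(V^{[n]}\otimes i^{[n]}b^{[n]})c$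 and $c(V^{[n]}\otimes i^{[n]}b^{[n]})=(i^{[n]}b^{[n]}\otimes V^{[n]})c$ (these make sense as $c$ maps $P^{[n]}\otimes V^{[n]}$ into $V^{[n]}\otimes P^{[n]}$ and conversely). Then $U^{[n+1]}$ is by definition $U^{[n]}/\big((\mathrm{Id}-i^{[n]}b^{[n]})[P^{[n]}]\big)$ (quotient by the two-sided ideal generated) with the unique braided bialgebra structure making the projection $\pi_n^{n+1}:U^{[n]}\to U^{[n+1]}$ a braided bialgebra map, and $i^{[n+1]}=P(\pi_n^{n+1})i^{[n]}$. The universal enveloping algebra is the direct limit $U(V,c,b)=\varinjlim U^{[n]}$ (a braided bialgebra), with canonical map $i_U:V\to U(V,c,b)$. $(V,c,b)$ is a braided Lie algebra if $i_U$ is injective. *)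

theory Defs
  imports "HOL-Algebra.Module" "HOL-Algebra.QuotRing"
begin

section \<open>Linear maps, quotients and free objects\<close>

text \<open>Vector spaces over a field \<open>K\<close> are \<^term>\<open>module K M\<close>.  The fields \<^const>\<open>mult\<close> and
  \<^const>\<open>one\<close> of the record are meaningful only where an algebra is intended.\<close>

definition linear_map ::
  "('k,'m) ring_scheme \<Rightarrow> ('k,'a,'n) module_scheme \<Rightarrow> ('k,'b,'o) module_scheme \<Rightarrow> ('a \<Rightarrow> 'b) \<Rightarrow> bool"
  where "linear_map K M N f \<longleftrightarrow>
    f \<in> carrier M \<rightarrow> carrier N \<and>
    (\<forall>x\<in>carrier M. \<forall>y\<in>carrier M. f (x \<oplus>\<^bsub>M\<^esub> y) = f x \<oplus>\<^bsub>N\<^esub> f y) \<and>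
    (\<forall>a\<in>carrier K. \<forall>x\<in>carrier M. f (a \<odot>\<^bsub>M\<^esub> x) = a \<odot>\<^bsub>N\<^esub> f x)"

definition scalars :: "('k,'m) ring_scheme \<Rightarrow> ('k,'k) module"
  where "scalars K = \<lparr>carrier = carrier K, mult = mult K, one = \<one>\<^bsub>K\<^esub>, zero = \<zero>\<^bsub>K\<^esub>,
    add = add K, smult = mult K\<rparr>"

definition unital_algebra :: "('k,'m) ring_scheme \<Rightarrow> ('k,'a,'n) module_scheme \<Rightarrow> bool"
  where "unital_algebra K A \<longleftrightarrow> module K A \<and> ring A \<and>
    (\<forall>a\<in>carrier K. \<forall>x\<in>carrier A. \<forall>y\<in>carrier A.
      (a \<odot>\<^bsub>A\<^esub> x) \<otimes>\<^bsub>A\<^esub> y = a \<odot>\<^bsub>A\<^esub> (x \<otimes>\<^bsub>A\<^esub> y) \<and> x \<otimes>\<^bsub>A\<^esub> (a \<odot>\<^bsub>A\<^esub> y) = a \<odot>\<^bsub>A\<^esub> (x \<otimes>\<^bsub>A\<^esub> y))"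

definition span_of :: "('k,'m) ring_scheme \<Rightarrow> ('k,'a,'n) module_scheme \<Rightarrow> 'a set \<Rightarrow> 'a set"
  where "span_of K M S = \<Inter>{N. submodule N K M \<and> S \<subseteq> N}"

text \<open>The ring part is that of \<^term>\<open>M Quot N\<close>.  This serves both for vector spaces modulo a
  subspace and for algebras modulo a two-sided ideal.\<close>

definition quot :: "('k,'a,'n) module_scheme \<Rightarrow> 'a set \<Rightarrow> ('k,'a set) module"
  where "quot M N = \<lparr>carrier = a_rcosets\<^bsub>M\<^esub> N, mult = rcoset_mult M N, one = N +>\<^bsub>M\<^esub> \<one>\<^bsub>M\<^esub>,
    zero = N, add = set_add M, smult = (\<lambda>a X. \<Union>x\<in>X. N +>\<^bsub>M\<^esub> (a \<odot>\<^bsub>M\<^esub> x))\<rparr>"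

definition single :: "('k,'m) ring_scheme \<Rightarrow> 'x \<Rightarrow> 'x \<Rightarrow> 'k"
  where "single K x = (\<lambda>y. if y = x then \<one>\<^bsub>K\<^esub> else \<zero>\<^bsub>K\<^esub>)"

definition free_module :: "('k,'m) ring_scheme \<Rightarrow> 'x set \<Rightarrow> ('k,'x \<Rightarrow> 'k) module"
  where "free_module K X =
    \<lparr>carrier = {f. range f \<subseteq> carrier K \<and> {x. f x \<noteq> \<zero>\<^bsub>K\<^esub>} \<subseteq> X \<and> finite {x. f x \<noteq> \<zero>\<^bsub>K\<^esub>}},
     mult = undefined, one = undefined,
     zero = (\<lambda>_. \<zero>\<^bsub>K\<^esub>), add = (\<lambda>f g x. f x \<oplus>\<^bsub>K\<^esub> g x), smult = (\<lambda>a f x. a \<otimes>\<^bsub>K\<^esub> f x)\<rparr>"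

text \<open>The free algebra has the words over \<open>X\<close> as basis and concatenation as product.\<close>

definition free_algebra :: "('k,'m) ring_scheme \<Rightarrow> 'x set \<Rightarrow> ('k,'x list \<Rightarrow> 'k) module"
  where "free_algebra K X = (free_module K (lists X))
    \<lparr>mult := (\<lambda>f g w. \<Oplus>\<^bsub>K\<^esub>j\<in>{..length w}. f (take j w) \<otimes>\<^bsub>K\<^esub> g (drop j w)), one := single K []\<rparr>"


section \<open>Tensor products\<close>

type_synonym ('k,'a,'b) tensor = "('a \<times> 'b \<Rightarrow> 'k) set"

definition tensor_relations ::
  "('k,'m) ring_scheme \<Rightarrow> ('k,'a,'n) module_scheme \<Rightarrow> ('k,'b,'o) module_scheme \<Rightarrow> ('a \<times> 'b \<Rightarrow> 'k) set"
  where "tensor_relations K M N = (let F = free_module K (carrier M \<times> carrier N) in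
    {single K (x \<oplus>\<^bsub>M\<^esub> x', y) \<ominus>\<^bsub>F\<^esub> (single K (x, y) \<oplus>\<^bsub>F\<^esub> single K (x', y)) | x x' y.
       x \<in> carrier M \<and> x' \<in> carrier M \<and> y \<in> carrier N} \<union>
    {single K (x, y \<oplus>\<^bsub>N\<^esub> y') \<ominus>\<^bsub>F\<^esub> (single K (x, y) \<oplus>\<^bsub>F\<^esub> single K (x, y')) | x y y'.
       x \<in> carrier M \<and> y \<in> carrier N \<and> y' \<in> carrier N} \<union>
    {single K (a \<odot>\<^bsub>M\<^esub> x, y) \<ominus>\<^bsub>F\<^esub> (a \<odot>\<^bsub>F\<^esub> single K (x, y)) | a x y.
       a \<in> carrier K \<and> x \<in> carrier M \<and> y \<in> carrier N} \<union>
    {single K (x, a \<odot>\<^bsub>N\<^esub> y) \<ominus>\<^bsub>F\<^esub> (a \<odot>\<^bsub>F\<^esub> single K (x, y)) | a x y.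
       a \<in> carrier K \<and> x \<in> carrier M \<and> y \<in> carrier N})"

definition tensor_kernel ::
  "('k,'m) ring_scheme \<Rightarrow> ('k,'a,'n) module_scheme \<Rightarrow> ('k,'b,'o) module_scheme \<Rightarrow> ('a \<times> 'b \<Rightarrow> 'k) set"
  where "tensor_kernel K M N =
    span_of K (free_module K (carrier M \<times> carrier N)) (tensor_relations K M N)"

definition tensor ::
  "('k,'m) ring_scheme \<Rightarrow> ('k,'a,'n) module_scheme \<Rightarrow> ('k,'b,'o) module_scheme
    \<Rightarrow> ('k, ('k,'a,'b) tensor) module"
  where "tensor K M N = quot (free_module K (carrier M \<times> carrier N)) (tensor_kernel K M N)"

definition tens ::
  "('k,'m) ring_scheme \<Rightarrow> ('k,'a,'n) module_scheme \<Rightarrow> ('k,'b,'o) module_scheme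
    \<Rightarrow> 'a \<Rightarrow> 'b \<Rightarrow> ('k,'a,'b) tensor"
  where "tens K M N x y =
    tensor_kernel K M N +>\<^bsub>free_module K (carrier M \<times> carrier N)\<^esub> single K (x, y)"

text \<open>The linear map \<open>M \<otimes> N \<rightarrow> Q\<close> with \<open>x \<otimes> y \<mapsto> B x y\<close>.  For bilinear \<open>B\<close> the value does not depend
  on the representative \<open>r\<close> of the tensor \<open>t\<close>.\<close>

definition tensor_lift ::
  "('k,'m) ring_scheme \<Rightarrow> ('k,'c,'n) module_scheme \<Rightarrow> ('a \<Rightarrow> 'b \<Rightarrow> 'c) \<Rightarrow> ('k,'a,'b) tensor \<Rightarrow> 'c"
  where "tensor_lift K Q B t = (let r = (SOME r. r \<in> t) in
    \<Oplus>\<^bsub>Q\<^esub>p\<in>{p. r p \<noteq> \<zero>\<^bsub>K\<^esub>}. r p \<odot>\<^bsub>Q\<^esub> B (fst p) (snd p))"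

text \<open>\<open>f \<otimes> g : M \<otimes> N \<rightarrow> M' \<otimes> N'\<close>; only the codomains have to be given.\<close>

definition tensor_map ::
  "('k,'m) ring_scheme \<Rightarrow> ('k,'c,'n) module_scheme \<Rightarrow> ('k,'d,'o) module_scheme
    \<Rightarrow> ('a \<Rightarrow> 'c) \<Rightarrow> ('b \<Rightarrow> 'd) \<Rightarrow> ('k,'a,'b) tensor \<Rightarrow> ('k,'c,'d) tensor"
  where "tensor_map K M' N' f g =
    tensor_lift K (tensor K M' N') (\<lambda>x y. tens K M' N' (f x) (g y))"

text \<open>The associator \<open>(L \<otimes> M) \<otimes> N \<rightarrow> L \<otimes> (M \<otimes> N)\<close> and its inverse.\<close>

definition assoc ::
  "('k,'m) ring_scheme \<Rightarrow> ('k,'a,'n) module_scheme \<Rightarrow> ('k,'b,'o) module_scheme \<Rightarrow> ('k,'c,'p) module_scheme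
    \<Rightarrow> ('k, ('k,'a,'b) tensor, 'c) tensor \<Rightarrow> ('k, 'a, ('k,'b,'c) tensor) tensor"
  where "assoc K L M N = (let T = tensor K L (tensor K M N) in
    tensor_lift K T (\<lambda>t z. tensor_lift K T (\<lambda>x y. tens K L (tensor K M N) x (tens K M N y z)) t))"

definition assoc_inv ::
  "('k,'m) ring_scheme \<Rightarrow> ('k,'a,'n) module_scheme \<Rightarrow> ('k,'b,'o) module_scheme \<Rightarrow> ('k,'c,'p) module_scheme
    \<Rightarrow> ('k, 'a, ('k,'b,'c) tensor) tensor \<Rightarrow> ('k, ('k,'a,'b) tensor, 'c) tensor"
  where "assoc_inv K L M N = (let T = tensor K (tensor K L M) N in
    tensor_lift K T (\<lambda>x t. tensor_lift K T (\<lambda>y z. tens K (tensor K L M) N (tens K L M x y) z) t))"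


section \<open>Braided objects\<close>

record ('k,'a) braided_module = "('k,'a) module" +
  braid :: "('k,'a,'a) tensor \<Rightarrow> ('k,'a,'a) tensor"

record ('k,'a) braided_bialg = "('k,'a) braided_module" +
  comult :: "'a \<Rightarrow> ('k,'a,'a) tensor"
  counit :: "'a \<Rightarrow> 'k"

text \<open>Threefold tensor powers are bracketed as \<open>(A \<otimes> A) \<otimes> A\<close>.  The following are
  \<open>c \<otimes> A\<close> and \<open>A \<otimes> c\<close> on it, and \<open>m \<otimes> A\<close>, \<open>A \<otimes> m\<close> from it.\<close>

definition braid_l :: "('k,'m) ring_scheme \<Rightarrow> ('k,'a,'n) braided_module_scheme
    \<Rightarrow> ('k, ('k,'a,'a) tensor, 'a) tensor \<Rightarrow> ('k, ('k,'a,'a) tensor, 'a) tensor"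
  where "braid_l K A = tensor_map K (tensor K A A) A (braid A) id"

definition braid_r :: "('k,'m) ring_scheme \<Rightarrow> ('k,'a,'n) braided_module_scheme
    \<Rightarrow> ('k, ('k,'a,'a) tensor, 'a) tensor \<Rightarrow> ('k, ('k,'a,'a) tensor, 'a) tensor"
  where "braid_r K A =
    assoc_inv K A A A \<circ> tensor_map K A (tensor K A A) id (braid A) \<circ> assoc K A A A"

definition mult_map :: "('k,'m) ring_scheme \<Rightarrow> ('k,'a,'n) module_scheme \<Rightarrow> ('k,'a,'a) tensor \<Rightarrow> 'a"
  where "mult_map K A = tensor_lift K A (mult A)"

definition mult_l :: "('k,'m) ring_scheme \<Rightarrow> ('k,'a,'n) module_scheme
    \<Rightarrow> ('k, ('k,'a,'a) tensor, 'a) tensor \<Rightarrow> ('k,'a,'a) tensor"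
  where "mult_l K A = tensor_map K A A (mult_map K A) id"

definition mult_r :: "('k,'m) ring_scheme \<Rightarrow> ('k,'a,'n) module_scheme
    \<Rightarrow> ('k, ('k,'a,'a) tensor, 'a) tensor \<Rightarrow> ('k,'a,'a) tensor"
  where "mult_r K A = tensor_map K A A id (mult_map K A) \<circ> assoc K A A A"

text \<open>\<open>\<Delta> \<otimes> C\<close> and \<open>C \<otimes> \<Delta>\<close> into \<open>(C \<otimes> C) \<otimes> C\<close>; \<open>\<epsilon> \<otimes> C\<close> and \<open>C \<otimes> \<epsilon>\<close> with \<open>K \<otimes> C\<close> and
  \<open>C \<otimes> K\<close> identified with \<open>C\<close>.\<close>

definition comult_l :: "('k,'m) ring_scheme \<Rightarrow> ('k,'a,'n) braided_bialg_scheme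
    \<Rightarrow> ('k,'a,'a) tensor \<Rightarrow> ('k, ('k,'a,'a) tensor, 'a) tensor"
  where "comult_l K C = tensor_map K (tensor K C C) C (comult C) id"

definition comult_r :: "('k,'m) ring_scheme \<Rightarrow> ('k,'a,'n) braided_bialg_scheme
    \<Rightarrow> ('k,'a,'a) tensor \<Rightarrow> ('k, ('k,'a,'a) tensor, 'a) tensor"
  where "comult_r K C = assoc_inv K C C C \<circ> tensor_map K C (tensor K C C) id (comult C)"

definition counit_l :: "('k,'m) ring_scheme \<Rightarrow> ('k,'a,'n) braided_bialg_scheme
    \<Rightarrow> ('k,'a,'a) tensor \<Rightarrow> 'a"
  where "counit_l K C = tensor_lift K C (\<lambda>x y. counit C x \<odot>\<^bsub>C\<^esub> y)"

definition counit_r :: "('k,'m) ring_scheme \<Rightarrow> ('k,'a,'n) braided_bialg_scheme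
    \<Rightarrow> ('k,'a,'a) tensor \<Rightarrow> 'a"
  where "counit_r K C = tensor_lift K C (\<lambda>x y. counit C y \<odot>\<^bsub>C\<^esub> x)"

definition braided_vector_space ::
  "('k,'m) ring_scheme \<Rightarrow> ('k,'a,'n) braided_module_scheme \<Rightarrow> bool"
  where "braided_vector_space K V \<longleftrightarrow>
    field K \<and> module K V \<and>
    linear_map K (tensor K V V) (tensor K V V) (braid V) \<and>
    (\<forall>t\<in>carrier (tensor K (tensor K V V) V).
      braid_l K V (braid_r K V (braid_l K V t)) = braid_r K V (braid_l K V (braid_r K V t)))"

definition braided_hom ::
  "('k,'m) ring_scheme \<Rightarrow> ('k,'a,'n) braided_module_scheme \<Rightarrow> ('k,'b,'o) braided_module_scheme
    \<Rightarrow> ('a \<Rightarrow> 'b) \<Rightarrow> bool"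
  where "braided_hom K V W f \<longleftrightarrow>
    linear_map K V W f \<and>
    (\<forall>t\<in>carrier (tensor K V V).
      braid W (tensor_map K W W f f t) = tensor_map K W W f f (braid V t))"

definition braided_algebra ::
  "('k,'m) ring_scheme \<Rightarrow> ('k,'a,'n) braided_module_scheme \<Rightarrow> bool"
  where "braided_algebra K A \<longleftrightarrow>
    braided_vector_space K A \<and> unital_algebra K A \<and>
    (\<forall>t\<in>carrier (tensor K (tensor K A A) A).
      braid A (mult_l K A t) = mult_r K A (braid_l K A (braid_r K A t)) \<and>
      braid A (mult_r K A t) = mult_l K A (braid_r K A (braid_l K A t))) \<and>
    (\<forall>x\<in>carrier A.
      braid A (tens K A A \<one>\<^bsub>A\<^esub> x) = tens K A A x \<one>\<^bsub>A\<^esub> \<and>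
      braid A (tens K A A x \<one>\<^bsub>A\<^esub>) = tens K A A \<one>\<^bsub>A\<^esub> x)"

definition braided_coalgebra ::
  "('k,'m) ring_scheme \<Rightarrow> ('k,'a,'n) braided_bialg_scheme \<Rightarrow> bool"
  where "braided_coalgebra K C \<longleftrightarrow>
    braided_vector_space K C \<and>
    linear_map K C (tensor K C C) (comult C) \<and>
    linear_map K C (scalars K) (counit C) \<and>
    (\<forall>x\<in>carrier C.
      comult_l K C (comult C x) = comult_r K C (comult C x) \<and>
      counit_l K C (comult C x) = x \<and> counit_r K C (comult C x) = x) \<and>
    (\<forall>t\<in>carrier (tensor K C C).
      comult_l K C (braid C t) = braid_r K C (braid_l K C (comult_r K C t)) \<and>
      comult_r K C (braid C t) = braid_l K C (braid_r K C (comult_l K C t)) \<and>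
      counit_l K C (braid C t) = counit_r K C t \<and>
      counit_r K C (braid C t) = counit_l K C t)"

text \<open>\<open>(m \<otimes> m)(A \<otimes> c \<otimes> A)\<close>, the multiplication map of \<open>A \<otimes>\<^sub>c A\<close>.\<close>

definition mult_tensor_square :: "('k,'m) ring_scheme \<Rightarrow> ('k,'a,'n) braided_module_scheme
    \<Rightarrow> ('k, ('k,'a,'a) tensor, ('k,'a,'a) tensor) tensor \<Rightarrow> ('k,'a,'a) tensor"
  where "mult_tensor_square K A =
    tensor_map K A A (mult_map K A) (mult_map K A) \<circ>
    assoc K (tensor K A A) A A \<circ>
    tensor_map K (tensor K (tensor K A A) A) A (braid_r K A) id \<circ>
    assoc_inv K (tensor K A A) A A"

definition braided_bialgebra ::
  "('k,'m) ring_scheme \<Rightarrow> ('k,'a,'n) braided_bialg_scheme \<Rightarrow> bool"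
  where "braided_bialgebra K B \<longleftrightarrow>
    braided_algebra K B \<and> braided_coalgebra K B \<and>
    (\<forall>t\<in>carrier (tensor K B B).
      comult B (mult_map K B t) =
        mult_tensor_square K B
          (tensor_map K (tensor K B B) (tensor K B B) (comult B) (comult B) t)) \<and>
    comult B \<one>\<^bsub>B\<^esub> = tens K B B \<one>\<^bsub>B\<^esub> \<one>\<^bsub>B\<^esub> \<and>
    counit B \<in> ring_hom B K"

definition braided_bialgebra_hom ::
  "('k,'m) ring_scheme \<Rightarrow> ('k,'a,'n) braided_bialg_scheme \<Rightarrow> ('k,'b,'o) braided_bialg_scheme
    \<Rightarrow> ('a \<Rightarrow> 'b) \<Rightarrow> bool"
  where "braided_bialgebra_hom K A B f \<longleftrightarrow>
    braided_hom K A B f \<and> f \<in> ring_hom A B \<and>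
    (\<forall>x\<in>carrier A.
      comult B (f x) = tensor_map K B B f f (comult A x) \<and> counit B (f x) = counit A x)"

definition primitives :: "('k,'m) ring_scheme \<Rightarrow> ('k,'a,'n) braided_bialg_scheme \<Rightarrow> 'a set"
  where "primitives K B =
    {x \<in> carrier B. comult B x = tens K B B x \<one>\<^bsub>B\<^esub> \<oplus>\<^bsub>tensor K B B\<^esub> tens K B B \<one>\<^bsub>B\<^esub> x}"

text \<open>\<open>B\<close> is the quotient of \<open>A\<close> by the two-sided ideal \<open>I\<close>, with canonical projection \<open>p\<close>:
  an isomorphism from the algebra of cosets onto \<open>B\<close> turns \<open>x \<mapsto> I + x\<close> into \<open>p\<close>, and the braided
  bialgebra structure of \<open>B\<close> makes \<open>p\<close> a braided bialgebra map.  The isomorphism is there so that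
  \<open>B\<close> may live on the same type as \<open>A\<close>, which allows quotients to be iterated.\<close>

definition quotient_bialgebra ::
  "('k,'m) ring_scheme \<Rightarrow> ('k,'a,'n) braided_bialg_scheme \<Rightarrow> 'a set
    \<Rightarrow> ('k,'b,'o) braided_bialg_scheme \<Rightarrow> ('a \<Rightarrow> 'b) \<Rightarrow> bool"
  where "quotient_bialgebra K A I B p \<longleftrightarrow>
    ideal I A \<and> braided_bialgebra K B \<and> braided_bialgebra_hom K A B p \<and>
    (\<exists>\<theta>\<in>ring_iso (A Quot I) B. \<forall>x\<in>carrier A. p x = \<theta> (I +>\<^bsub>A\<^esub> x))"


section \<open>The braided tensor algebra\<close>

type_synonym ('k,'v) tensor_alg = "('v list \<Rightarrow> 'k) set"

text \<open>\<open>T(V)\<close> is the free algebra on the elements of \<open>V\<close> modulo the relations making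
  \<open>V \<rightarrow> T(V)\<close> linear.\<close>

definition tensor_algebra_ideal ::
  "('k,'m) ring_scheme \<Rightarrow> ('k,'v,'n) module_scheme \<Rightarrow> ('v list \<Rightarrow> 'k) set"
  where "tensor_algebra_ideal K V = (let F = free_algebra K (carrier V) in Idl\<^bsub>F\<^esub>
    ({single K [x \<oplus>\<^bsub>V\<^esub> y] \<ominus>\<^bsub>F\<^esub> (single K [x] \<oplus>\<^bsub>F\<^esub> single K [y]) | x y.
        x \<in> carrier V \<and> y \<in> carrier V} \<union>
     {single K [a \<odot>\<^bsub>V\<^esub> x] \<ominus>\<^bsub>F\<^esub> (a \<odot>\<^bsub>F\<^esub> single K [x]) | a x.
        a \<in> carrier K \<and> x \<in> carrier V}))"

definition tensor_algebra ::
  "('k,'m) ring_scheme \<Rightarrow> ('k,'v,'n) module_scheme \<Rightarrow> ('k, ('k,'v) tensor_alg) module"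
  where "tensor_algebra K V = quot (free_algebra K (carrier V)) (tensor_algebra_ideal K V)"

definition tensor_algebra_incl ::
  "('k,'m) ring_scheme \<Rightarrow> ('k,'v,'n) module_scheme \<Rightarrow> 'v \<Rightarrow> ('k,'v) tensor_alg"
  where "tensor_algebra_incl K V v =
    tensor_algebra_ideal K V +>\<^bsub>free_algebra K (carrier V)\<^esub> single K [v]"

text \<open>\<open>T = T(V,c)\<close>.  The braiding makes \<open>T\<close> a braided algebra and extends that of \<open>V\<close>;
  comultiplication and counit are algebra maps to \<open>T \<otimes>\<^sub>c T\<close> and \<open>K\<close> with the prescribed values
  on \<open>V\<close>.  This determines all three on their carriers.\<close>

definition braided_tensor_algebra ::
  "('k,'m) ring_scheme \<Rightarrow> ('k,'v,'n) braided_module_scheme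
    \<Rightarrow> ('k, ('k,'v) tensor_alg) braided_bialg \<Rightarrow> bool"
  where "braided_tensor_algebra K V T \<longleftrightarrow> (let \<iota> = tensor_algebra_incl K V in
    module.truncate T = tensor_algebra K V \<and>
    braided_algebra K T \<and>
    (\<forall>t\<in>carrier (tensor K V V).
      braid T (tensor_map K T T \<iota> \<iota> t) = tensor_map K T T \<iota> \<iota> (braid V t)) \<and>
    linear_map K T (tensor K T T) (comult T) \<and>
    linear_map K T (scalars K) (counit T) \<and>
    (\<forall>x\<in>carrier T. \<forall>y\<in>carrier T.
      comult T (x \<otimes>\<^bsub>T\<^esub> y) =
        mult_tensor_square K T (tens K (tensor K T T) (tensor K T T) (comult T x) (comult T y))) \<and>
    comult T \<one>\<^bsub>T\<^esub> = tens K T T \<one>\<^bsub>T\<^esub> \<one>\<^bsub>T\<^esub> \<and>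
    counit T \<in> ring_hom T K \<and>
    (\<forall>v\<in>carrier V.
      comult T (\<iota> v) = tens K T T (\<iota> v) \<one>\<^bsub>T\<^esub> \<oplus>\<^bsub>tensor K T T\<^esub> tens K T T \<one>\<^bsub>T\<^esub> (\<iota> v) \<and>
      counit T (\<iota> v) = \<zero>\<^bsub>K\<^esub>))"


section \<open>Brackets\<close>

text \<open>A sequence of bialgebras \<open>U n\<close> with maps \<open>p n : U n \<rightarrow> U (n + 1)\<close>, where \<open>U 0 = T(V,c)\<close>,
  induces maps \<open>i\<^sup>[\<^sup>n\<^sup>] : V \<rightarrow> U n\<close>.\<close>

primrec stage_incl ::
  "('k,'m) ring_scheme \<Rightarrow> ('k,'v,'n) module_scheme
    \<Rightarrow> (nat \<Rightarrow> ('k,'v) tensor_alg \<Rightarrow> ('k,'v) tensor_alg) \<Rightarrow> nat \<Rightarrow> 'v \<Rightarrow> ('k,'v) tensor_alg"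
  where
    "stage_incl K V p 0 = tensor_algebra_incl K V"
  | "stage_incl K V p (Suc n) = p n \<circ> stage_incl K V p n"

text \<open>For subspaces \<open>X\<close>, \<open>Y\<close> of \<open>B\<close> with \<open>c(X \<otimes> Y) \<subseteq> Y \<otimes> X\<close>, the restriction
  \<open>X \<otimes> Y \<rightarrow> Y \<otimes> X\<close> of the braiding of \<open>B\<close>.  Here \<open>X \<otimes> Y\<close> is the tensor product of \<open>X\<close> and \<open>Y\<close>
  themselves, and \<open>tensor_map K B B id id\<close> is its (injective) canonical map to \<open>B \<otimes> B\<close>.\<close>

definition braid_restrict ::
  "('k,'m) ring_scheme \<Rightarrow> ('k,'a,'n) braided_module_scheme \<Rightarrow> 'a set \<Rightarrow> 'a set
    \<Rightarrow> ('k,'a,'a) tensor \<Rightarrow> ('k,'a,'a) tensor"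
  where "braid_restrict K B X Y t =
    (THE s. s \<in> carrier (tensor K (B\<lparr>carrier := Y\<rparr>) (B\<lparr>carrier := X\<rparr>)) \<and>
      tensor_map K B B id id s = braid B (tensor_map K B B id id t))"

text \<open>The maps \<open>b n : P(U n) \<rightarrow> V\<close> form a bracket on \<open>(V,c)\<close>, with associated sequence of
  braided bialgebras \<open>U n\<close> and projections \<open>p n\<close>.\<close>

definition bracket ::
  "('k,'m) ring_scheme \<Rightarrow> ('k,'v,'n) braided_module_scheme
    \<Rightarrow> (nat \<Rightarrow> ('k,'v) tensor_alg \<Rightarrow> 'v)
    \<Rightarrow> (nat \<Rightarrow> ('k, ('k,'v) tensor_alg) braided_bialg)
    \<Rightarrow> (nat \<Rightarrow> ('k,'v) tensor_alg \<Rightarrow> ('k,'v) tensor_alg) \<Rightarrow> bool"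
  where "bracket K V b U p \<longleftrightarrow>
    braided_vector_space K V \<and>
    braided_tensor_algebra K V (U 0) \<and>
    (\<forall>n. let P = primitives K (U n); i = stage_incl K V p n; W = i ` carrier V;
             P' = (U n)\<lparr>carrier := P\<rparr>; W' = (U n)\<lparr>carrier := W\<rparr>; ib = i \<circ> b n
      in braided_bialgebra K (U n) \<and>
         braided_hom K V (U n) i \<and> W \<subseteq> P \<and>
         linear_map K P' V (b n) \<and>
         (\<forall>t\<in>carrier (tensor K P' W').
           braid_restrict K (U n) W W (tensor_map K W' W' ib id t) =
             tensor_map K W' W' id ib (braid_restrict K (U n) P W t)) \<and>
         (\<forall>t\<in>carrier (tensor K W' P').
           braid_restrict K (U n) W W (tensor_map K W' W' id ib t) =
             tensor_map K W' W' ib id (braid_restrict K (U n) W P t)) \<and>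
         quotient_bialgebra K (U n) (Idl\<^bsub>U n\<^esub> {x \<ominus>\<^bsub>U n\<^esub> ib x | x. x \<in> P}) (U (Suc n)) (p n))"


section \<open>The universal enveloping algebra\<close>

primrec shift :: "(nat \<Rightarrow> 'u \<Rightarrow> 'u) \<Rightarrow> nat \<Rightarrow> nat \<Rightarrow> 'u \<Rightarrow> 'u"
  where
    "shift p n 0 x = x"
  | "shift p n (Suc k) x = p (n + k) (shift p n k x)"

text \<open>The composite \<open>U n \<rightarrow> U m\<close> of the projections, for \<open>n \<le> m\<close>.\<close>

definition trans_map :: "(nat \<Rightarrow> 'u \<Rightarrow> 'u) \<Rightarrow> nat \<Rightarrow> nat \<Rightarrow> 'u \<Rightarrow> 'u"
  where "trans_map p n m = shift p n (m - n)"

text \<open>Elements of the direct limit are classes of pairs \<open>(n, x)\<close> with \<open>x\<close> in \<open>U n\<close>, two pairs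
  being identified if they have the same image in some \<open>U l\<close>.\<close>

definition lim_rel ::
  "(nat \<Rightarrow> ('u,'n) partial_object_scheme) \<Rightarrow> (nat \<Rightarrow> 'u \<Rightarrow> 'u) \<Rightarrow> ((nat \<times> 'u) \<times> (nat \<times> 'u)) set"
  where "lim_rel U p = {((n, x), (m, y)) | n x m y. x \<in> carrier (U n) \<and> y \<in> carrier (U m) \<and>
    (\<exists>l. n \<le> l \<and> m \<le> l \<and> trans_map p n l x = trans_map p m l y)}"

definition lim_incl ::
  "(nat \<Rightarrow> ('u,'n) partial_object_scheme) \<Rightarrow> (nat \<Rightarrow> 'u \<Rightarrow> 'u) \<Rightarrow> nat \<Rightarrow> 'u \<Rightarrow> (nat \<times> 'u) set"
  where "lim_incl U p n x = lim_rel U p `` {(n, x)}"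

text \<open>A binary operation on the limit induced by operations \<open>f n\<close> on the \<open>U n\<close>.\<close>

definition lim_op ::
  "(nat \<Rightarrow> ('u,'n) partial_object_scheme) \<Rightarrow> (nat \<Rightarrow> 'u \<Rightarrow> 'u) \<Rightarrow> (nat \<Rightarrow> 'u \<Rightarrow> 'u \<Rightarrow> 'u)
    \<Rightarrow> (nat \<times> 'u) set \<Rightarrow> (nat \<times> 'u) set \<Rightarrow> (nat \<times> 'u) set"
  where "lim_op U p f S T = (\<Union>(n, x)\<in>S. \<Union>(m, y)\<in>T. let l = max n m in
    lim_incl U p l (f l (trans_map p n l x) (trans_map p m l y)))"

definition lim_module ::
  "(nat \<Rightarrow> ('k,'u,'n) module_scheme) \<Rightarrow> (nat \<Rightarrow> 'u \<Rightarrow> 'u) \<Rightarrow> ('k, (nat \<times> 'u) set) module"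
  where "lim_module U p =
    \<lparr>carrier = (SIGMA n:UNIV. carrier (U n)) // lim_rel U p,
     mult = lim_op U p (\<lambda>n. mult (U n)), one = lim_incl U p 0 \<one>\<^bsub>U 0\<^esub>,
     zero = lim_incl U p 0 \<zero>\<^bsub>U 0\<^esub>, add = lim_op U p (\<lambda>n. add (U n)),
     smult = (\<lambda>a S. \<Union>(n, x)\<in>S. lim_incl U p n (a \<odot>\<^bsub>U n\<^esub> x))\<rparr>"

text \<open>In the braiding and the comultiplication, the unions are over equal sets, namely cosets in
  the sense of \<^const>\<open>quot\<close>; every tensor over the limit comes from some \<open>U n\<close>.\<close>

definition direct_limit ::
  "('k,'m) ring_scheme \<Rightarrow> (nat \<Rightarrow> ('k,'u,'n) braided_bialg_scheme) \<Rightarrow> (nat \<Rightarrow> 'u \<Rightarrow> 'u)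
    \<Rightarrow> ('k, (nat \<times> 'u) set) braided_bialg"
  where "direct_limit K U p = (let L = lim_module U p;
      \<kappa> = (\<lambda>n. tensor_map K L L (lim_incl U p n) (lim_incl U p n)) in
    \<lparr>carrier = carrier L, mult = mult L, one = one L, zero = zero L, add = add L, smult = smult L,
     braid = (\<lambda>t. \<Union>{\<kappa> n (braid (U n) s) | n s. s \<in> carrier (tensor K (U n) (U n)) \<and> \<kappa> n s = t}),
     comult = (\<lambda>S. \<Union>(n, x)\<in>S. \<kappa> n (comult (U n) x)),
     counit = (\<lambda>S. THE e. \<exists>(n, x)\<in>S. e = counit (U n) x)\<rparr>)"

text \<open>\<open>U(V,c,b)\<close> is \<^term>\<open>direct_limit K U p\<close>; the canonical map from \<open>V\<close> to it is
  \<open>i\<^sub>U\<close>, which is injective precisely for braided Lie algebras.\<close>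

definition canonical_map ::
  "('k,'m) ring_scheme \<Rightarrow> ('k,'v,'n) module_scheme
    \<Rightarrow> (nat \<Rightarrow> ('k, ('k,'v) tensor_alg) braided_bialg)
    \<Rightarrow> (nat \<Rightarrow> ('k,'v) tensor_alg \<Rightarrow> ('k,'v) tensor_alg)
    \<Rightarrow> 'v \<Rightarrow> (nat \<times> ('k,'v) tensor_alg) set"
  where "canonical_map K V U p = lim_incl U p 0 \<circ> stage_incl K V p 0"

definition braided_Lie_algebra ::
  "('k,'m) ring_scheme \<Rightarrow> ('k,'v,'n) braided_module_scheme
    \<Rightarrow> (nat \<Rightarrow> ('k,'v) tensor_alg \<Rightarrow> 'v)
    \<Rightarrow> (nat \<Rightarrow> ('k, ('k,'v) tensor_alg) braided_bialg)
    \<Rightarrow> (nat \<Rightarrow> ('k,'v) tensor_alg \<Rightarrow> ('k,'v) tensor_alg) \<Rightarrow> bool"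
  where "braided_Lie_algebra K V b U p \<longleftrightarrow>
    bracket K V b U p \<and> inj_on (canonical_map K V U p) (carrier V)"

end

theory Submission
  imports Defs
begin

text \<open>The two ideals have the same generators: \<open>Ker b = {x - i b x | x \<in> P}\<close> at each stage \<open>n\<close>.
  Each \<open>i\<^sup>[\<^sup>n\<^sup>+\<^sup>1\<^sup>]\<close> is injective because \<open>i\<^sub>U\<close> factors through it.  For \<open>v \<in> V\<close> the element \<open>i v - i b i v\<close>
  dies in \<open>U\<^sup>[\<^sup>n\<^sup>+\<^sup>1\<^sup>]\<close>, so \<open>i\<^sup>[\<^sup>n\<^sup>+\<^sup>1\<^sup>] v = i\<^sup>[\<^sup>n\<^sup>+\<^sup>1\<^sup>] (b i v)\<close> and hence \<open>b i = id\<close>.  Then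
  \<open>b (x - i b x) = 0\<close>, while \<open>x = x - i b x\<close> for \<open>x \<in> Ker b\<close>.\<close>

section \<open>Additive structure of tensor products\<close>

text \<open>On carrier, addition and zero, \<open>quot\<close> coincides with the factor group
  \<open>A_FactGroup\<close>, so the group axioms carry over; only these fields matter for
  \<open>abelian_group\<close>.\<close>

lemma abelian_group_quot:
  assumes "abelian_subgroup N M"
  shows "abelian_group (quot M N)"
proof -
  interpret G: comm_group "A_FactGroup M N"
    using assms by (rule abelian_subgroup.a_factorgroup_is_comm_group)
  have eqs: "carrier (quot M N) = carrier (A_FactGroup M N)"
      "add (quot M N) = mult (A_FactGroup M N)" "zero (quot M N) = one (A_FactGroup M N)"
    by (simp_all add: quot_def A_FactGroup_def FactGroup_def A_RCOSETS_def set_add_def fun_eq_iff)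
  show ?thesis
    by (rule abelian_groupI; unfold eqs)
      (rule G.m_closed G.one_closed G.m_assoc G.m_comm G.l_one G.l_inv_ex; assumption)+
qed

lemma abelian_group_free_module:
  assumes "ring K"
  shows "abelian_group (free_module K X)"
proof -
  interpret ring K by fact
  \<comment> \<open>Bounds the support of a sum, so that it stays finite and inside
    \<open>X\<close>.\<close>
  have sum: "{x. f x \<oplus>\<^bsub>K\<^esub> g x \<noteq> \<zero>\<^bsub>K\<^esub>} \<subseteq> {x. f x \<noteq> \<zero>\<^bsub>K\<^esub>} \<union> {x. g x \<noteq> \<zero>\<^bsub>K\<^esub>}" for f g
    by auto
  show ?thesis
  proof (rule abelian_groupI)
    fix f g assume "f \<in> carrier (free_module K X)" "g \<in> carrier (free_module K X)"
    then show "f \<oplus>\<^bsub>free_module K X\<^esub> g \<in> carrier (free_module K X)"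
      using sum[of f g] finite_subset[OF sum[of f g]]
      by (auto simp: free_module_def image_subset_iff)
  next
    fix f assume f: "f \<in> carrier (free_module K X)"
    then have c: "f x \<in> carrier K" for x
      by (auto simp: free_module_def)
    then have "(\<lambda>x. \<ominus>\<^bsub>K\<^esub> f x) \<in> carrier (free_module K X)"
      using f by (auto simp: free_module_def)
    then show "\<exists>g\<in>carrier (free_module K X). g \<oplus>\<^bsub>free_module K X\<^esub> f = \<zero>\<^bsub>free_module K X\<^esub>"
      using c by (intro bexI[of _ "\<lambda>x. \<ominus>\<^bsub>K\<^esub> f x"]) (auto simp: free_module_def l_neg)
  qed (auto simp: free_module_def image_subset_iff add.m_ac)
qed

text \<open>Makes the family of submodules intersected in \<open>span_of\<close> nonempty, and also
  supplies closure under scalars for the tensor relations.\<close>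

lemma submodule_carrier_free_module:
  assumes "ring K"
  shows "submodule (carrier (free_module K X)) K (free_module K X)"
proof -
  interpret ring K by fact
  interpret F: abelian_group "free_module K X"
    using assms by (rule abelian_group_free_module)
  show ?thesis
  proof (intro submodule.intro submodule_axioms.intro)
    show "subgroup (carrier (free_module K X)) (add_monoid (free_module K X))"
      using F.add.subgroup_self by simp
    fix a f assume a: "a \<in> carrier K" and f: "f \<in> carrier (free_module K X)"
    have "{x. a \<otimes>\<^bsub>K\<^esub> f x \<noteq> \<zero>\<^bsub>K\<^esub>} \<subseteq> {x. f x \<noteq> \<zero>\<^bsub>K\<^esub>}"
      using a by auto
    with a f show "a \<odot>\<^bsub>free_module K X\<^esub> f \<in> carrier (free_module K X)"
      using finite_subset by (auto simp: free_module_def image_subset_iff)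
  qed
qed

lemma single_closed:
  assumes "ring K" "x \<in> X"
  shows "single K x \<in> carrier (free_module K X)"
proof -
  interpret ring K by fact
  have "{y. single K x y \<noteq> \<zero>\<^bsub>K\<^esub>} \<subseteq> {x}"
    by (auto simp: single_def)
  then show ?thesis
    using assms(2) finite_subset by (auto simp: free_module_def single_def)
qed

text \<open>An intersection of a nonempty family of subgroups is a subgroup; the whole carrier is a
  member of the family.\<close>

lemma abelian_subgroup_span_of:
  assumes "abelian_group M" "submodule (carrier M) K M" "S \<subseteq> carrier M"
  shows "abelian_subgroup (span_of K M S) M"
proof -
  interpret abelian_group M by fact
  have "subgroup (span_of K M S) (add_monoid M)"
    unfolding span_of_def using assms(2,3)
    by (intro add.subgroups_Inter) (auto simp: submodule_def)
  then show ?thesis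
    using abelian_subgroupI3 additive_subgroup.intro assms(1) by blast
qed

context
  fixes K :: "('k,'m) ring_scheme" and M :: "('k,'a,'n) module_scheme"
    and N :: "('k,'b,'o) module_scheme"
  assumes K: "ring K" and M: "module K M" and N: "module K N"
begin

interpretation M: module K M by (rule M)
interpretation N: module K N by (rule N)

private abbreviation (input) "F \<equiv> free_module K (carrier M \<times> carrier N)"

interpretation F: abelian_group F
  using K by (rule abelian_group_free_module)

lemma tensor_relations_subset: "tensor_relations K M N \<subseteq> carrier F"
proof -
  have smult: "a \<odot>\<^bsub>F\<^esub> f \<in> carrier F" if "a \<in> carrier K" "f \<in> carrier F" for a f
    using submodule.smult_closed[OF submodule_carrier_free_module[OF K] that] .
  show ?thesis
    unfolding tensor_relations_def Let_def
    by (auto intro!: F.minus_closed F.add.m_closed smult single_closed K)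
qed

lemma tensor_kernel_subgroup: "abelian_subgroup (tensor_kernel K M N) F"
  unfolding tensor_kernel_def
  by (intro abelian_subgroup_span_of F.abelian_group_axioms submodule_carrier_free_module K
      tensor_relations_subset)

interpretation R: abelian_subgroup "tensor_kernel K M N" F
  by (rule tensor_kernel_subgroup)

lemma tensor_abelian_group: "abelian_group (tensor K M N)"
  unfolding tensor_def by (rule abelian_group_quot) (rule tensor_kernel_subgroup)

lemma tens_closed:
  assumes "x \<in> carrier M" "y \<in> carrier N"
  shows "tens K M N x y \<in> carrier (tensor K M N)"
  using assms unfolding tens_def tensor_def quot_def
  by (auto intro!: F.a_rcosetsI single_closed K R.a_subset)

text \<open>Every tensor relation is a difference \<open>f - g\<close>, and
  \<open>f = (f - g) + g\<close> then lies in the coset of \<open>g\<close>. Both additivity laws of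
  \<open>tens\<close> come from this, combined with the fact that a coset of a sum is the sum of the
  cosets.\<close>

lemma coset_eq_of_relation:
  assumes "f \<in> carrier F" "g \<in> carrier F" "f \<ominus>\<^bsub>F\<^esub> g \<in> tensor_relations K M N"
  shows "tensor_kernel K M N +>\<^bsub>F\<^esub> f = tensor_kernel K M N +>\<^bsub>F\<^esub> g"
proof -
  have "f \<ominus>\<^bsub>F\<^esub> g \<in> tensor_kernel K M N"
    using assms(3) by (auto simp: tensor_kernel_def span_of_def)
  moreover have "f = (f \<ominus>\<^bsub>F\<^esub> g) \<oplus>\<^bsub>F\<^esub> g"
    using assms by (simp add: a_minus_def F.a_assoc F.l_neg)
  ultimately have "f \<in> tensor_kernel K M N +>\<^bsub>F\<^esub> g"
    unfolding a_r_coset_def' by auto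
  then show ?thesis
    using R.a_repr_independence' assms(2) by metis
qed

lemma tens_add_left:
  assumes "x \<in> carrier M" "x' \<in> carrier M" "y \<in> carrier N"
  shows "tens K M N (x \<oplus>\<^bsub>M\<^esub> x') y = tens K M N x y \<oplus>\<^bsub>tensor K M N\<^esub> tens K M N x' y"
proof -
  have "single K (x \<oplus>\<^bsub>M\<^esub> x', y) \<ominus>\<^bsub>F\<^esub> (single K (x, y) \<oplus>\<^bsub>F\<^esub> single K (x', y))
      \<in> tensor_relations K M N"
    using assms unfolding tensor_relations_def Let_def by blast
  then show ?thesis
    using assms unfolding tens_def
    by (simp add: tensor_def quot_def R.a_rcos_sum single_closed K coset_eq_of_relation)
qed

lemma tens_add_right:
  assumes "x \<in> carrier M" "y \<in> carrier N" "y' \<in> carrier N"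
  shows "tens K M N x (y \<oplus>\<^bsub>N\<^esub> y') = tens K M N x y \<oplus>\<^bsub>tensor K M N\<^esub> tens K M N x y'"
proof -
  have "single K (x, y \<oplus>\<^bsub>N\<^esub> y') \<ominus>\<^bsub>F\<^esub> (single K (x, y) \<oplus>\<^bsub>F\<^esub> single K (x, y'))
      \<in> tensor_relations K M N"
    using assms unfolding tensor_relations_def Let_def by blast
  then show ?thesis
    using assms unfolding tens_def
    by (simp add: tensor_def quot_def R.a_rcos_sum single_closed K coset_eq_of_relation)
qed

end

text \<open>With \<open>d = x - y\<close>, the equation \<open>x = d + y\<close> lets additivity of
  the comultiplication and of \<open>tens\<close> do the work: \<open>comult d\<close> plus the
  primitive form \<open>?\<delta> y\<close> equals \<open>?\<delta> d\<close> plus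
  \<open>?\<delta> y\<close>, and \<open>?\<delta> y\<close> cancels in the tensor product.
  Negatives of tensors never appear.\<close>

lemma primitives_minus_closed:
  assumes B: "braided_bialgebra K B" and x: "x \<in> primitives K B" and y: "y \<in> primitives K B"
  shows "x \<ominus>\<^bsub>B\<^esub> y \<in> primitives K B"
proof -
  have "field K" "module K B" "ring B" and lin: "linear_map K B (tensor K B B) (comult B)"
    using B by (auto simp: braided_bialgebra_def braided_algebra_def braided_coalgebra_def
        braided_vector_space_def unital_algebra_def)
  then interpret B: ring B by simp
  have K: "ring K"
    using \<open>field K\<close> by (simp add: field_def domain_def cring_def)
  note mods = K \<open>module K B\<close> \<open>module K B\<close>
  let ?T = "tensor K B B"
  interpret T: abelian_group ?T
    by (rule tensor_abelian_group[OF mods])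
  define d where "d = x \<ominus>\<^bsub>B\<^esub> y"
  have xc: "x \<in> carrier B" and yc: "y \<in> carrier B"
    using x y by (auto simp: primitives_def)
  then have dc: "d \<in> carrier B" and xd: "x = d \<oplus>\<^bsub>B\<^esub> y"
    by (auto simp: d_def a_minus_def B.a_assoc B.l_neg)
  let ?\<delta> = "\<lambda>z. tens K B B z \<one>\<^bsub>B\<^esub> \<oplus>\<^bsub>?T\<^esub> tens K B B \<one>\<^bsub>B\<^esub> z"
  have tc [simp]: "tens K B B u v \<in> carrier ?T" if "u \<in> carrier B" "v \<in> carrier B" for u v
    using tens_closed[OF mods that] .
  have cc: "comult B d \<in> carrier ?T"
    using lin dc by (auto simp: linear_map_def)
  have "comult B d \<oplus>\<^bsub>?T\<^esub> ?\<delta> y = comult B x"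
    using lin dc yc y by (simp add: linear_map_def xd primitives_def)
  also have "\<dots> = ?\<delta> (d \<oplus>\<^bsub>B\<^esub> y)"
    using x by (simp add: primitives_def xd)
  also have "\<dots> = ?\<delta> d \<oplus>\<^bsub>?T\<^esub> ?\<delta> y"
    using dc yc by (simp add: tens_add_left[OF mods] tens_add_right[OF mods] T.a_ac)
  finally have "comult B d = ?\<delta> d"
    using cc dc yc by (metis T.add.m_closed T.add.right_cancel B.one_closed tc)
  then show ?thesis
    using dc by (simp add: primitives_def d_def)
qed

section \<open>The maps into the direct limit\<close>

lemma shift_add: "shift p n (k + j) x = shift p (n + k) j (shift p n k x)"
  by (induction j) (simp_all add: add.assoc)

text \<open>Elements that merge at a later stage have the same relatives under
  \<open>lim_rel\<close>; by symmetry one inclusion of classes suffices.\<close>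

lemma lim_incl_eqI:
  assumes "x \<in> carrier (U n)" "y \<in> carrier (U n)" "n \<le> k"
    and eq: "trans_map p n k x = trans_map p n k y"
  shows "lim_incl U p n x = lim_incl U p n y"
proof -
  have trans: "trans_map p i j z = trans_map p l j (trans_map p i l z)" if "i \<le> l" "l \<le> j" for i l j z
    using that shift_add[of p i "l - i" "j - l" z] by (simp add: trans_map_def)
  have "lim_incl U p n x \<subseteq> lim_incl U p n y"
    if x: "x \<in> carrier (U n)" and y: "y \<in> carrier (U n)"
      and eq: "trans_map p n k x = trans_map p n k y" for x y
  proof
    fix s assume "s \<in> lim_incl U p n x"
    then obtain m z l where s: "s = (m, z)" "z \<in> carrier (U m)" "n \<le> l" "m \<le> l"
      and e: "trans_map p n l x = trans_map p m l z"
      by (auto simp: lim_incl_def lim_rel_def)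
    \<comment> \<open>\<open>x\<close> meets \<open>z\<close> by stage \<open>l\<close> and meets
      \<open>y\<close> by stage \<open>k\<close>, so at stage \<open>j\<close> all three images
      agree.\<close>
    define j where "j = max l k"
    have j: "l \<le> j" "k \<le> j" by (auto simp: j_def)
    have "trans_map p n j y = trans_map p n j x"
      using trans[OF \<open>n \<le> k\<close> j(2)] eq by simp
    also have "\<dots> = trans_map p m j z"
      using trans[OF \<open>n \<le> l\<close> j(1)] trans[OF \<open>m \<le> l\<close> j(1)] e by simp
    finally have "trans_map p n j y = trans_map p m j z" .
    then show "s \<in> lim_incl U p n y"
      using s x y j by (auto simp: lim_incl_def lim_rel_def intro!: exI[of _ j])
  qed
  from this[OF assms(1,2) eq] this[OF assms(2,1) eq[symmetric]] show ?thesis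
    by blast
qed

lemma stage_incl_eq_trans_map: "stage_incl K V p n v = trans_map p 0 n (stage_incl K V p 0 v)"
  by (induction n) (simp_all add: trans_map_def)

text \<open>The canonical map factors through each stage: if two vectors agree at stage
  \<open>n\<close>, their stage 0 images define the same class in the limit.\<close>

lemma stage_incl_inj_on:
  assumes "inj_on (canonical_map K V U p) (carrier V)"
    and "stage_incl K V p 0 \<in> carrier V \<rightarrow> carrier (U 0)"
  shows "inj_on (stage_incl K V p n) (carrier V)"
proof (rule inj_onI)
  fix v w assume v: "v \<in> carrier V" and w: "w \<in> carrier V"
    and eq: "stage_incl K V p n v = stage_incl K V p n w"
  have "lim_incl U p 0 (stage_incl K V p 0 v) = lim_incl U p 0 (stage_incl K V p 0 w)"
    using eq v w assms(2) unfolding stage_incl_eq_trans_map[of K V p n]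
    by (intro lim_incl_eqI) (auto simp: Pi_iff)
  then show "v = w"
    using assms(1) v w by (auto simp: canonical_map_def inj_on_def)
qed

text \<open>The projection is a function of the coset, through the isomorphism in
  \<open>quotient_bialgebra\<close>, and congruent elements have equal cosets.\<close>

lemma quotient_bialgebra_eqI:
  assumes Q: "quotient_bialgebra K A I B p" and "ring A"
    and x: "x \<in> carrier A" and y: "y \<in> carrier A" and xy: "x \<ominus>\<^bsub>A\<^esub> y \<in> I"
  shows "p x = p y"
proof -
  interpret ideal I A
    using Q by (simp add: quotient_bialgebra_def)
  have "I +>\<^bsub>A\<^esub> x = I +>\<^bsub>A\<^esub> y"
    using quotient_eq_iff_same_a_r_cos[OF ideal_axioms x y] xy by simp
  then show ?thesis
    using Q x y by (auto simp: quotient_bialgebra_def)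
qed

section \<open>The generators of the defining ideal are the kernel of the bracket\<close>

theorem corollary5p8:
  fixes K :: "('k,'m) ring_scheme"
    and V :: "('k,'v,'n) braided_module_scheme"
    and b :: "nat \<Rightarrow> ('k,'v) tensor_alg \<Rightarrow> 'v"
    and U :: "nat \<Rightarrow> ('k, ('k,'v) tensor_alg) braided_bialg"
    and p :: "nat \<Rightarrow> ('k,'v) tensor_alg \<Rightarrow> ('k,'v) tensor_alg"
  assumes "field K"
    and "braided_Lie_algebra K V b U p"
  shows "\<forall>n. quotient_bialgebra K (U n)
    (Idl\<^bsub>U n\<^esub> (a_kernel ((U n)\<lparr>carrier := primitives K (U n)\<rparr>) V (b n))) (U (Suc n)) (p n)"
proof
  fix n
  let ?i = "stage_incl K V p"
  let ?P = "primitives K (U n)"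
  let ?G = "{x \<ominus>\<^bsub>U n\<^esub> (?i n \<circ> b n) x | x. x \<in> ?P}"
  have bracket: "bracket K V b U p" and inj: "inj_on (canonical_map K V U p) (carrier V)"
    using assms(2) by (auto simp: braided_Lie_algebra_def)
  from bracket have "module K V"
    by (simp add: bracket_def braided_vector_space_def)
  then interpret V: module K V .
  have stage: "braided_bialgebra K (U m)" "linear_map K V (U m) (?i m)"
      "?i m ` carrier V \<subseteq> primitives K (U m)"
      "linear_map K ((U m)\<lparr>carrier := primitives K (U m)\<rparr>) V (b m)"
      "quotient_bialgebra K (U m) (Idl\<^bsub>U m\<^esub> {x \<ominus>\<^bsub>U m\<^esub> (?i m \<circ> b m) x | x. x \<in> primitives K (U m)})
        (U (Suc m)) (p m)" for m
    using bracket by (simp_all add: bracket_def Let_def braided_hom_def)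
  note Q = stage(5)[of n]
  from stage(1)[of n] have "ring (U n)"
    by (simp add: braided_bialgebra_def braided_algebra_def unital_algebra_def)
  then interpret Un: ring "U n" .
  have Pc: "?P \<subseteq> carrier (U n)"
    by (auto simp: primitives_def)
  have iP: "?i n v \<in> ?P" if "v \<in> carrier V" for v
    using stage(3)[of n] that by auto
  \<comment> \<open>Additivity makes the image of zero an additive idempotent, hence zero.\<close>
  have i0: "?i n \<zero>\<^bsub>V\<^esub> = \<zero>\<^bsub>U n\<^esub>"
  proof -
    have "?i n \<zero>\<^bsub>V\<^esub> \<oplus>\<^bsub>U n\<^esub> ?i n \<zero>\<^bsub>V\<^esub> = ?i n (\<zero>\<^bsub>V\<^esub> \<oplus>\<^bsub>V\<^esub> \<zero>\<^bsub>V\<^esub>)"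
      using stage(2)[of n] by (metis V.zero_closed linear_map_def)
    then show ?thesis
      using iP[OF V.zero_closed] Pc by (simp add: subset_iff)
  qed
  have bV: "b n x \<in> carrier V" if "x \<in> ?P" for x
    using stage(4)[of n] that by (auto simp: linear_map_def)
  have badd: "b n (x \<oplus>\<^bsub>U n\<^esub> y) = b n x \<oplus>\<^bsub>V\<^esub> b n y" if "x \<in> ?P" "y \<in> ?P" for x y
    using stage(4)[of n] that by (auto simp: linear_map_def)
  \<comment> \<open>The generators are primitive, so \<open>b n\<close> may be evaluated on
    them.\<close>
  have G: "?G \<subseteq> ?P"
    using primitives_minus_closed[OF stage(1)] iP bV by auto
  \<comment> \<open>Injectivity is taken one stage up, because the generators vanish only in
    \<open>U (Suc n)\<close>.\<close>
  have inj_Suc: "inj_on (?i (Suc n)) (carrier V)"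
    by (rule stage_incl_inj_on[OF inj]) (use stage(2)[of 0] in \<open>simp add: linear_map_def\<close>)
  have retract: "b n (?i n v) = v" if v: "v \<in> carrier V" for v
  proof -
    let ?w = "b n (?i n v)"
    have w: "?w \<in> carrier V"
      using bV iP v by blast
    \<comment> \<open>\<open>?i n v\<close> is itself primitive and serves as the \<open>x\<close>
      in the description of \<open>?G\<close>.\<close>
    have "?i n v \<ominus>\<^bsub>U n\<^esub> ?i n ?w \<in> ?G"
      using iP[OF v] by auto
    moreover have "?G \<subseteq> Idl\<^bsub>U n\<^esub> ?G"
      using G Pc by (intro Un.genideal_self) blast
    ultimately have "?i n v \<ominus>\<^bsub>U n\<^esub> ?i n ?w \<in> Idl\<^bsub>U n\<^esub> ?G"
      by blast
    then have "p n (?i n v) = p n (?i n ?w)"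
      using iP[OF v] iP[OF w] Pc
      by (intro quotient_bialgebra_eqI[OF Q \<open>ring (U n)\<close>]) blast+
    then have "?i (Suc n) v = ?i (Suc n) ?w"
      by simp
    then show ?thesis
      using inj_Suc v w by (metis inj_onD)
  qed
  have "?G = {x \<in> ?P. b n x = \<zero>\<^bsub>V\<^esub>}"
  proof (intro equalityI subsetI)
    fix d assume d: "d \<in> ?G"
    then obtain x where x: "x \<in> ?P" and dx: "d = x \<ominus>\<^bsub>U n\<^esub> ?i n (b n x)"
      by auto
    have dP: "d \<in> ?P" and ibP: "?i n (b n x) \<in> ?P"
      using d G iP bV x by auto
    \<comment> \<open>Additivity of \<open>b n\<close> applies to this sum of primitives. By
      \<open>retract\<close> the second summand contributes \<open>b n x\<close> again, which forces
      \<open>b n d\<close> to be zero.\<close>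
    have "x = d \<oplus>\<^bsub>U n\<^esub> ?i n (b n x)"
      using x ibP Pc by (simp add: dx a_minus_def Un.a_assoc Un.l_neg subset_iff)
    then have "b n x = b n d \<oplus>\<^bsub>V\<^esub> b n x"
      using badd[OF dP ibP] retract[OF bV[OF x]] by simp
    then show "d \<in> {x \<in> ?P. b n x = \<zero>\<^bsub>V\<^esub>}"
      using dP bV[OF dP] bV[OF x] by simp
  next
    fix x assume x: "x \<in> {x \<in> ?P. b n x = \<zero>\<^bsub>V\<^esub>}"
    \<comment> \<open>A kernel element is its own generator: the subtracted term is
      \<open>?i n\<close> of zero, which vanishes by \<open>i0\<close>.\<close>
    then have "x = x \<ominus>\<^bsub>U n\<^esub> (?i n \<circ> b n) x"
      using Pc by (auto simp: i0 a_minus_def)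
    with x show "x \<in> ?G" by blast
  qed
  \<comment> \<open>Restricting the carrier to \<open>?P\<close> makes \<open>a_kernel\<close> the
    kernel within the primitives. Since the generating sets are equal, the quotient property
    \<open>Q\<close> is already the claim.\<close>
  then have "a_kernel ((U n)\<lparr>carrier := ?P\<rparr>) V (b n) = ?G"
    by (simp add: a_kernel_def kernel_def)
  with Q show "quotient_bialgebra K (U n)
    (Idl\<^bsub>U n\<^esub> (a_kernel ((U n)\<lparr>carrier := primitives K (U n)\<rparr>) V (b n))) (U (Suc n)) (p n)"
    by simp
qed

end
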